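(* Let $\varepsilon \in (0,1]$ be a constant. In the $\varepsilon$-clairvoyant model of single-machine preemptive scheduling with online job arrivals, the deterministic algorithm SLF (Shortest Lower-bound First) is $\lceil 1/\varepsilon \rceil$-competitive for the objective of minimizing the total flow time.
   Context: Single-machine preemptive scheduling: each job $j$ has a release time $q_j \ge 0$ and a processing time $p_j>0$; jobs arrive online at their release times, at most one job is processed at any instant (processing several jobs "in parallel at equal pace" means time-sharing with infinitesimally small steps), and preemption is allowed. For a schedule, $e_j(t)$ is the elapsed time (amount of processing job $j$ received by time $t$), $r_j(t)=p_j-e_j(t)$ its remaining processing time, and $C_j$ its completion time; the objective is the total flow time $\sum_j (C_j-q_j)$. In the $\varepsilon$-clairvoyant model, $p_j$ is unknown to the algorithm when $j$ arrives and is revealed at the moment when $r_j(t)\le \varepsilon p_j$; a job in the queue is called known if $r_j(t)\le\varepsilon p_j$ and unknown otherwise. Algorithm SLF: at time $t$, for each active job define the estimate $\eta_j(t)=\frac{\varepsilon}{1-\varepsilon}e_j(t)$ if $j$ is unknown and $\eta_j(t)=r_j(t)$ if $j$ is known. If the minimum estimate over known jobs is at most the minimum estimate over unknown jobs, SLF processes an (arbitrary) known job of minimum estimate; otherwise it processes all unknown jobs of minimum estimate in parallel at equal pace. An algorithm is $\rho$-competitive if on every instance its total flow time is at most $\rho$ times the optimal total flow time. *)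

theory Defs
  imports "HOL-Analysis.Analysis"
begin

record 'j job_instance =
  jobs :: "'j set"
  release :: "'j \<Rightarrow> real"
  proc :: "'j \<Rightarrow> real"

definition valid_instance :: "'j job_instance \<Rightarrow> bool" where
  "valid_instance I \<longleftrightarrow> finite (jobs I) \<and> (\<forall>j\<in>jobs I. 0 \<le> release I j \<and> 0 < proc I j)"

text \<open>
  A schedule gives, for every job and every time, the fraction of the machine devoted to
  that job. A job that is processed alone has rate 1; infinitesimal time-sharing among
  several jobs is expressed by fractional rates of sum at most 1.
\<close>

type_synonym 'j schedule = "'j \<Rightarrow> real \<Rightarrow> real"

definition elapsed :: "'j schedule \<Rightarrow> 'j \<Rightarrow> real \<Rightarrow> real" where
  "elapsed x j t = integral {0..t} (x j)"

definition remaining :: "'j job_instance \<Rightarrow> 'j schedule \<Rightarrow> 'j \<Rightarrow> real \<Rightarrow> real" where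
  "remaining I x j t = proc I j - elapsed x j t"

definition active :: "'j job_instance \<Rightarrow> 'j schedule \<Rightarrow> real \<Rightarrow> 'j set" where
  "active I x t = {j \<in> jobs I. release I j \<le> t \<and> 0 < remaining I x j t}"

definition feasible :: "'j job_instance \<Rightarrow> 'j schedule \<Rightarrow> bool" where
  "feasible I x \<longleftrightarrow>
     (\<forall>j\<in>jobs I. \<forall>t\<ge>0. x j integrable_on {0..t}) \<and>
     (\<forall>j\<in>jobs I. \<forall>t\<ge>0. 0 \<le> x j t) \<and>
     (\<forall>t\<ge>0. (\<Sum>j\<in>jobs I. x j t) \<le> 1) \<and>
     (\<forall>j\<in>jobs I. \<forall>t\<ge>0. j \<notin> active I x t \<longrightarrow> x j t = 0)"

text \<open>The completion time is \<open>\<infinity>\<close> (infimum of the empty set) for a job that never finishes.\<close>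

definition completion_time :: "'j job_instance \<Rightarrow> 'j schedule \<Rightarrow> 'j \<Rightarrow> ereal" where
  "completion_time I x j = (INF t \<in> {t. release I j \<le> t \<and> remaining I x j t \<le> 0}. ereal t)"

definition total_flow_time :: "'j job_instance \<Rightarrow> 'j schedule \<Rightarrow> ereal" where
  "total_flow_time I x = (\<Sum>j\<in>jobs I. completion_time I x j - ereal (release I j))"

definition opt_flow_time :: "'j job_instance \<Rightarrow> ereal" where
  "opt_flow_time I = (INF x \<in> {x. feasible I x}. total_flow_time I x)"

text \<open>
  What an \<open>\<epsilon>\<close>-clairvoyant algorithm sees of an active job: its elapsed time, together with
  its processing time once this has been revealed.
\<close>

datatype job_view = Unknown (view_elapsed: real) | Known (view_elapsed: real) (view_proc: real)

type_synonym 'j queue = "'j \<rightharpoonup> job_view"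

definition queue_at :: "real \<Rightarrow> 'j job_instance \<Rightarrow> 'j schedule \<Rightarrow> real \<Rightarrow> 'j queue" where
  "queue_at \<epsilon> I x t = (\<lambda>j.
     if j \<notin> active I x t then None
     else if remaining I x j t \<le> \<epsilon> * proc I j then Some (Known (elapsed x j t) (proc I j))
     else Some (Unknown (elapsed x j t)))"

definition known_jobs :: "'j queue \<Rightarrow> 'j set" where
  "known_jobs Q = {j. \<exists>e p. Q j = Some (Known e p)}"

definition unknown_jobs :: "'j queue \<Rightarrow> 'j set" where
  "unknown_jobs Q = {j. \<exists>e. Q j = Some (Unknown e)}"

text \<open>
  A policy maps the visible queue to the set of rate vectors it allows; more than one
  element means that ties may be broken arbitrarily.
\<close>

type_synonym 'j policy = "'j queue \<Rightarrow> ('j \<Rightarrow> real) set"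

definition policy_run ::
    "real \<Rightarrow> 'j policy \<Rightarrow> 'j job_instance \<Rightarrow> 'j schedule \<Rightarrow> bool" where
  "policy_run \<epsilon> P I x \<longleftrightarrow>
     feasible I x \<and> (\<forall>t\<ge>0. (\<lambda>j. x j t) \<in> P (queue_at \<epsilon> I x t))"

definition competitive :: "real \<Rightarrow> 'j policy \<Rightarrow> real \<Rightarrow> bool" where
  "competitive \<epsilon> P \<rho> \<longleftrightarrow>
     (\<forall>I x. valid_instance I \<longrightarrow> policy_run \<epsilon> P I x \<longrightarrow>
        total_flow_time I x \<le> ereal \<rho> * opt_flow_time I)"

text \<open>For \<open>\<epsilon> = 1\<close> no active job is ever unknown, so the division by zero is never used.\<close>

fun view_estimate :: "real \<Rightarrow> job_view \<Rightarrow> real" where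
  "view_estimate \<epsilon> (Unknown e) = \<epsilon> / (1 - \<epsilon>) * e"
| "view_estimate \<epsilon> (Known e p) = p - e"

definition estimate :: "real \<Rightarrow> 'j queue \<Rightarrow> 'j \<Rightarrow> real" where
  "estimate \<epsilon> Q j = view_estimate \<epsilon> (the (Q j))"

definition min_estimate_jobs :: "real \<Rightarrow> 'j queue \<Rightarrow> 'j set \<Rightarrow> 'j set" where
  "min_estimate_jobs \<epsilon> Q S = {j. is_arg_min (estimate \<epsilon> Q) (\<lambda>j. j \<in> S) j}"

text \<open>The minimum estimate over an empty set of jobs is \<open>\<infinity>\<close>.\<close>

definition min_estimate :: "real \<Rightarrow> 'j queue \<Rightarrow> 'j set \<Rightarrow> ereal" where
  "min_estimate \<epsilon> Q S = (INF j \<in> S. ereal (estimate \<epsilon> Q j))"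

definition equal_pace :: "'j set \<Rightarrow> 'j \<Rightarrow> real" where
  "equal_pace S j = (if j \<in> S then 1 / real (card S) else 0)"

definition SLF :: "real \<Rightarrow> 'j policy" where
  "SLF \<epsilon> Q =
     (if dom Q = {} then {\<lambda>_. 0}
      else if min_estimate \<epsilon> Q (known_jobs Q) \<le> min_estimate \<epsilon> Q (unknown_jobs Q)
      then {equal_pace {j} | j. j \<in> min_estimate_jobs \<epsilon> Q (known_jobs Q)}
      else {equal_pace (min_estimate_jobs \<epsilon> Q (unknown_jobs Q))})"

end

theory Submission
  imports Defs
begin

text \<open>
  Fix a time \<open>T\<close> and a competing schedule, and let \<open>M\<close> be the set of jobs it still has at
  \<open>T\<close>. It has finished all other jobs released before \<open>T\<close>, so the slack
  \<open>\<sigma> t\<close>, namely \<open>T - t\<close> minus the total processing time of the jobs outside \<open>M\<close>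
  released in \<open>[t, T)\<close>, is nonnegative. With \<open>K = \<lceil>1 / \<epsilon>\<rceil>\<close>, if all \<open>n\<close> jobs pending in
  SLF at time \<open>t\<close> have remaining time at least \<open>\<theta>\<close> and \<open>m\<close> jobs of \<open>M\<close> were released
  before \<open>t\<close>, then \<open>(n - K m) \<theta> \<le> \<sigma> t\<close>; for \<open>t = T\<close> this says \<open>n \<le> K |M|\<close>, and
  integrating over \<open>T\<close> compares the flow times.

  The inequality is proved by induction on the number of released jobs. Let \<open>\<theta>'\<close> be the
  second smallest remaining time at \<open>t\<close>, and \<open>t0\<close> the last moment before \<open>t\<close> at which SLF was
  idle or processed a job of estimate above \<open>\<theta>'\<close>. No two jobs can both fall to \<open>\<theta>'\<close> after
  the last arrival, so \<open>t0\<close> is at most the last release time before \<open>t\<close>. The jobs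
  pending at \<open>t0\<close> all have estimate at least \<open>\<theta>'\<close>, so the induction hypothesis applies there,
  and the work done after \<open>t0\<close> is at most \<open>\<theta>'\<close> on each of them, at most \<open>\<theta>' / \<epsilon>\<close> on each new
  job of \<open>M\<close>. Integrality of \<open>n - K m\<close> makes up for the one job whose remaining time may be
  below \<open>\<theta>'\<close>.
\<close>

section \<open>Integrals of rates that are never positive together\<close>

text \<open>Henstock's lemma makes the sum of the absolute errors of \<open>f\<close> small over
  every fine tagged division. Here the interval integrals vanish, so these errors are exactly the
  terms of a Riemann sum of the absolute value. This needs only gauge integrability of
  \<open>f\<close>, which is all that feasibility grants to a rate.\<close>

lemma has_integral_abs_zero:
  fixes f :: "real \<Rightarrow> real"
  assumes f: "f integrable_on {a..b}"
    and zero: "\<And>u v. a \<le> u \<Longrightarrow> u \<le> v \<Longrightarrow> v \<le> b \<Longrightarrow> integral {u..v} f = 0"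
  shows "((\<lambda>s. \<bar>f s\<bar>) has_integral 0) {a..b}"
proof -
  have f': "f integrable_on cbox a b" using f by simp
  have "((\<lambda>s. \<bar>f s\<bar>) has_integral 0) (cbox a b)"
    unfolding has_integral
  proof (intro allI impI)
    fix e :: real assume "e > 0"
    obtain \<gamma> where \<gamma>: "gauge \<gamma>"
      and small: "\<And>p. p tagged_partial_division_of cbox a b \<Longrightarrow> \<gamma> fine p \<Longrightarrow>
        (\<Sum>(x,k)\<in>p. norm (measure lborel k *\<^sub>R f x - integral k f)) < e"
      using that by (rule Henstock_lemma[OF f' \<open>e > 0\<close>])
    have main: "norm ((\<Sum>(x,k)\<in>p. measure lborel k *\<^sub>R \<bar>f x\<bar>) - 0) < e"
      if p: "p tagged_division_of cbox a b" and fine: "\<gamma> fine p" for p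
    proof -
      have int0: "integral k f = 0" if xk: "(x,k) \<in> p" for x k
      proof -
        obtain u v where k: "k = cbox u v" using tagged_division_ofD(4)[OF p xk] by blast
        have "k \<subseteq> cbox a b" "x \<in> k"
          using tagged_division_ofD(2,3)[OF p xk] by auto
        then have "a \<le> u" "u \<le> v" "v \<le> b" using k by auto
        then show ?thesis unfolding k cbox_interval by (rule zero)
      qed
      let ?S = "\<Sum>(x,k)\<in>p. measure lborel k *\<^sub>R \<bar>f x\<bar>"
      have "?S = (\<Sum>(x,k)\<in>p. norm (measure lborel k *\<^sub>R f x - integral k f))"
      proof (rule sum.cong, rule refl)
        fix z assume "z \<in> p"
        then show "(case z of (x, k) \<Rightarrow> measure lborel k *\<^sub>R \<bar>f x\<bar>)
            = (case z of (x, k) \<Rightarrow> norm (measure lborel k *\<^sub>R f x - integral k f))"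
          using int0[of "fst z" "snd z"] by (simp add: case_prod_beta abs_mult)
      qed
      also have "\<dots> < e"
        using p fine by (intro small) (auto simp: tagged_division_of_def)
      finally have "?S < e" .
      moreover have "0 \<le> ?S" by (rule sum_nonneg) auto
      ultimately show ?thesis unfolding diff_0_right real_norm_def by (simp only: abs_of_nonneg)
    qed
    show "\<exists>\<gamma>. gauge \<gamma> \<and> (\<forall>\<D>. \<D> tagged_division_of cbox a b \<and> \<gamma> fine \<D> \<longrightarrow>
        norm ((\<Sum>(x,k)\<in>\<D>. measure lborel k *\<^sub>R \<bar>f x\<bar>) - 0) < e)"
      by (intro exI[of _ \<gamma>] conjI allI impI \<gamma> main) (erule conjunct1 conjunct2)+
  qed
  then show ?thesis by simp
qed

text \<open>All interval integrals of \<open>f - g\<close> vanish, so its absolute value has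
  integral 0. Since at most one of the two nonnegative rates is positive at any time, that absolute
  value dominates \<open>f\<close>.\<close>

lemma disjoint_rates_equal_integrals_zero:
  fixes f g :: "real \<Rightarrow> real"
  assumes f: "f integrable_on {a..b}" and g: "g integrable_on {a..b}"
    and nonneg: "\<And>s. s \<in> {a..b} \<Longrightarrow> 0 \<le> f s" "\<And>s. s \<in> {a..b} \<Longrightarrow> 0 \<le> g s"
    and disj: "\<And>s. s \<in> {a..b} \<Longrightarrow> f s = 0 \<or> g s = 0"
    and eq: "\<And>u v. a \<le> u \<Longrightarrow> u \<le> v \<Longrightarrow> v \<le> b \<Longrightarrow> integral {u..v} f = integral {u..v} g"
  shows "integral {a..b} f = 0"
proof -
  have "((\<lambda>s. \<bar>f s - g s\<bar>) has_integral 0) {a..b}"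
  proof (rule has_integral_abs_zero)
    show "(\<lambda>s. f s - g s) integrable_on {a..b}" using f g by (rule integrable_diff)
    fix u v assume uv: "a \<le> u" "u \<le> v" "v \<le> b"
    have "f integrable_on {u..v}" "g integrable_on {u..v}"
      using f g uv by (auto intro: integrable_subinterval_real)
    then show "integral {u..v} (\<lambda>s. f s - g s) = 0"
      using eq[OF uv] by (simp add: integral_diff)
  qed
  moreover have "f s \<le> \<bar>f s - g s\<bar>" if "s \<in> {a..b}" for s
    using disj[OF that] nonneg[OF that] by auto
  ultimately have "integral {a..b} f \<le> 0"
    using has_integral_le[OF integrable_integral[OF f]] by blast
  moreover have "0 \<le> integral {a..b} f" using f nonneg by (intro integral_nonneg) auto
  ultimately show ?thesis by simp
qed

section \<open>Feasible schedules, work, and flow time as an integral\<close>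

locale feasible_schedule =
  fixes I :: "'j job_instance" and x :: "'j schedule"
  assumes valid: "valid_instance I" and feas: "feasible I x"
begin

lemma finite_jobs: "finite (jobs I)"
  using valid by (simp add: valid_instance_def)

lemma release_nonneg: "j \<in> jobs I \<Longrightarrow> 0 \<le> release I j"
  and proc_pos: "j \<in> jobs I \<Longrightarrow> 0 < proc I j"
  using valid by (auto simp: valid_instance_def)

lemma rate_nonneg: "j \<in> jobs I \<Longrightarrow> 0 \<le> s \<Longrightarrow> 0 \<le> x j s"
  and rate_sum_le: "0 \<le> s \<Longrightarrow> (\<Sum>j\<in>jobs I. x j s) \<le> 1"
  and rate_inactive: "j \<in> jobs I \<Longrightarrow> 0 \<le> s \<Longrightarrow> j \<notin> active I x s \<Longrightarrow> x j s = 0"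
  using feas by (auto simp: feasible_def)

lemma rate_integrable: "j \<in> jobs I \<Longrightarrow> 0 \<le> a \<Longrightarrow> x j integrable_on {a..b}"
proof (cases "a \<le> b")
  case True
  assume "j \<in> jobs I" "0 \<le> a"
  then have "x j integrable_on {0..b}" using feas True by (auto simp: feasible_def)
  then show ?thesis by (rule integrable_subinterval_real) (use \<open>0 \<le> a\<close> in auto)
qed (simp add: integrable_on_empty)

lemma elapsed_0: "elapsed x j 0 = 0"
  by (simp add: elapsed_def)

lemma elapsed_diff:
  assumes "j \<in> jobs I" "0 \<le> a" "a \<le> b"
  shows "elapsed x j b - elapsed x j a = integral {a..b} (x j)"
  using Henstock_Kurzweil_Integration.integral_combine[of 0 a b "x j"] rate_integrable[of j 0 b] assms
  by (simp add: elapsed_def)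

lemma elapsed_mono:
  assumes "j \<in> jobs I" "0 \<le> a" "a \<le> b"
  shows "elapsed x j a \<le> elapsed x j b"
proof -
  have "0 \<le> integral {a..b} (x j)"
    using assms by (intro integral_nonneg rate_integrable) (auto intro: rate_nonneg)
  then show ?thesis using elapsed_diff[OF assms] by simp
qed

lemma elapsed_nonneg: "j \<in> jobs I \<Longrightarrow> 0 \<le> s \<Longrightarrow> 0 \<le> elapsed x j s"
  using elapsed_mono[of j 0 s] by (simp add: elapsed_0)

lemma elapsed_continuous: "j \<in> jobs I \<Longrightarrow> 0 \<le> a \<Longrightarrow> continuous_on {a..b} (elapsed x j)"
proof -
  assume j: "j \<in> jobs I" and a: "0 \<le> a"
  have "continuous_on {0..b} (\<lambda>s. integral {0..s} (x j))"
    by (rule indefinite_integral_continuous_1) (simp add: j rate_integrable)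
  then have "continuous_on {0..b} (elapsed x j)" by (simp add: elapsed_def[abs_def])
  then show ?thesis by (rule continuous_on_subset) (use a in auto)
qed

lemma elapsed_IVT:
  assumes "j \<in> jobs I" "0 \<le> a" "a \<le> b" "elapsed x j a \<le> y" "y \<le> elapsed x j b"
  obtains u where "a \<le> u" "u \<le> b" "elapsed x j u = y"
  using IVT'[OF assms(4,5,3) elapsed_continuous[OF assms(1,2)]] that by blast

lemma elapsed_constant:
  assumes j: "j \<in> jobs I" and ab: "0 \<le> a" "a \<le> b"
    and zero: "\<And>s. a < s \<Longrightarrow> s < b \<Longrightarrow> x j s = 0"
  shows "elapsed x j b = elapsed x j a"
proof -
  have "integral {a..b} (x j) = integral {a<..<b} (x j)"
    by (simp add: integral_open_interval_real)
  also have "\<dots> = integral {a<..<b} (\<lambda>_. 0)"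
    by (rule integral_cong) (simp add: zero)
  finally show ?thesis using elapsed_diff[OF j ab] by simp
qed

lemma elapsed_before_release:
  assumes "j \<in> jobs I" "0 \<le> s" "s \<le> release I j"
  shows "elapsed x j s = 0"
proof -
  have "elapsed x j s = elapsed x j 0"
    using assms by (intro elapsed_constant) (auto intro!: rate_inactive simp: active_def)
  then show ?thesis by (simp add: elapsed_0)
qed

text \<open>Once the elapsed time reaches \<open>proc I j\<close>, monotonicity keeps the job
  inactive, and feasibility forbids further work on it.\<close>

lemma elapsed_le_proc:
  assumes j: "j \<in> jobs I" and s: "0 \<le> s"
  shows "elapsed x j s \<le> proc I j"
proof (rule ccontr)
  assume "\<not> ?thesis"
  then obtain u where u: "0 \<le> u" "u \<le> s" "elapsed x j u = proc I j"
    using elapsed_IVT[of j 0 s "proc I j"] j s proc_pos[OF j] elapsed_0[of j] by auto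
  have "x j v = 0" if "u < v" for v
    using elapsed_mono[OF j u(1), of v] that u
    by (intro rate_inactive j) (auto simp: active_def remaining_def)
  then have "elapsed x j s = elapsed x j u" using j u by (intro elapsed_constant) auto
  with u \<open>\<not> ?thesis\<close> show False by simp
qed

lemma remaining_antimono:
  "j \<in> jobs I \<Longrightarrow> 0 \<le> a \<Longrightarrow> a \<le> b \<Longrightarrow> remaining I x j b \<le> remaining I x j a"
  using elapsed_mono by (simp add: remaining_def)

lemma remaining_nonneg: "j \<in> jobs I \<Longrightarrow> 0 \<le> s \<Longrightarrow> 0 \<le> remaining I x j s"
  using elapsed_le_proc by (simp add: remaining_def)

lemma work_eq_integral:
  assumes D: "D \<subseteq> jobs I" and ab: "0 \<le> a" "a \<le> b"
  shows "(\<Sum>j\<in>D. elapsed x j b - elapsed x j a) = integral {a..b} (\<lambda>s. \<Sum>j\<in>D. x j s)"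
proof -
  have "finite D" using D finite_jobs finite_subset by blast
  then have "integral {a..b} (\<lambda>s. \<Sum>j\<in>D. x j s) = (\<Sum>j\<in>D. integral {a..b} (x j))"
    using D ab by (intro integral_sum) (auto intro: rate_integrable)
  then show ?thesis using D ab by (auto intro!: sum.cong elapsed_diff)
qed

lemma work_le:
  assumes D: "D \<subseteq> jobs I" and ab: "0 \<le> a" "a \<le> b"
  shows "(\<Sum>j\<in>D. elapsed x j b - elapsed x j a) \<le> b - a"
proof -
  have fin: "finite D" using D finite_jobs finite_subset by blast
  have "(\<Sum>j\<in>D. x j s) \<le> 1" if "s \<in> {a..b}" for s
  proof -
    have "(\<Sum>j\<in>D. x j s) \<le> (\<Sum>j\<in>jobs I. x j s)"
      using D that ab by (intro sum_mono2 finite_jobs) (auto intro: rate_nonneg)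
    also have "\<dots> \<le> 1" using that ab by (intro rate_sum_le) auto
    finally show ?thesis .
  qed
  then have "integral {a..b} (\<lambda>s. \<Sum>j\<in>D. x j s) \<le> integral {a..b} (\<lambda>_. 1)"
    using D fin ab by (intro integral_le integrable_sum) (auto intro: rate_integrable)
  then show ?thesis using work_eq_integral[OF assms] ab by simp
qed

lemma work_eq:
  assumes ab: "0 \<le> a" "a \<le> b"
    and busy: "\<And>s. a < s \<Longrightarrow> s < b \<Longrightarrow> (\<Sum>j\<in>jobs I. x j s) = 1"
  shows "(\<Sum>j\<in>jobs I. elapsed x j b - elapsed x j a) = b - a"
proof -
  have "integral {a..b} (\<lambda>s. \<Sum>j\<in>jobs I. x j s) = integral {a<..<b} (\<lambda>s. \<Sum>j\<in>jobs I. x j s)"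
    by (simp add: integral_open_interval_real)
  also have "\<dots> = integral {a<..<b} (\<lambda>_. 1::real)"
    by (rule integral_cong) (simp add: busy)
  also have "\<dots> = b - a" using ab by (simp add: integral_open_interval_real[symmetric])
  finally show ?thesis using work_eq_integral[OF order.refl ab] by simp
qed

text \<open>A barrier principle: by continuity, growth would have to pass through levels strictly
  between \<open>c\<close> and \<open>d\<close>, where the rate is zero.\<close>

lemma elapsed_stuck:
  assumes j: "j \<in> jobs I" and ut: "0 \<le> u" "u \<le> t"
    and idle: "\<And>s. u < s \<Longrightarrow> s < t \<Longrightarrow> c < elapsed x j s \<Longrightarrow> elapsed x j s < d \<Longrightarrow> x j s = 0"
    and start: "c \<le> elapsed x j u" "elapsed x j u < d"
  shows "elapsed x j t = elapsed x j u"
proof (rule ccontr)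
  let ?e = "elapsed x j"
  assume "?e t \<noteq> ?e u"
  then have less: "?e u < ?e t" using elapsed_mono[OF j ut] by simp
  \<comment> \<open>Two levels above the starting value and below both \<open>d\<close> and the
    final value. While the elapsed time climbs from \<open>z\<close> to \<open>y\<close>, it lies
    strictly inside the forbidden range.\<close>
  define y where "y = (?e u + min (?e t) d) / 2"
  define z where "z = (?e u + y) / 2"
  have y: "?e u < y" "y < d" "y < ?e t" and z: "?e u < z" "z < y"
    using less start by (auto simp: y_def z_def)
  obtain v where v: "u \<le> v" "v \<le> t" "?e v = y"
    using elapsed_IVT[OF j ut, of y] y by auto
  obtain w where w: "u \<le> w" "w \<le> v" "?e w = z"
    using elapsed_IVT[OF j ut(1) v(1), of z] z v by auto
  have "x j s = 0" if "w < s" "s < v" for s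
  proof (rule idle)
    have "?e w \<le> ?e s" "?e s \<le> ?e v" using that w ut by (auto intro!: elapsed_mono[OF j])
    then show "c < ?e s" "?e s < d" using w v z y start by auto
  qed (use that v w in auto)
  then have "?e v = ?e w" using ut w by (intro elapsed_constant[OF j]) auto
  with v w z show False by simp
qed

text \<open>The completion time is the infimum of the moments at which the job is done. Activity at
  the infimum itself is left open, since a single moment does not affect the integrals formed
  later.\<close>

lemma completion_time_finite:
  assumes j: "j \<in> jobs I" and t: "release I j \<le> t" "remaining I x j t \<le> 0"
  obtains c where "completion_time I x j = ereal c" "release I j \<le> c" "c \<le> t"
    "\<And>s. s \<noteq> c \<Longrightarrow> j \<in> active I x s \<longleftrightarrow> release I j \<le> s \<and> s < c"
proof -
  let ?S = "{t. release I j \<le> t \<and> remaining I x j t \<le> 0}"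
  have bdd: "bdd_below ?S" by (rule bdd_belowI[of _ "release I j"]) simp
  have ne: "?S \<noteq> {}" using t by blast
  show thesis
  proof (rule that[of "Inf ?S"])
    show "completion_time I x j = ereal (Inf ?S)"
      unfolding completion_time_def using ereal_Inf'[OF bdd ne] by simp
    show "release I j \<le> Inf ?S" using ne by (rule cInf_greatest) simp
    show "Inf ?S \<le> t" using bdd t by (intro cInf_lower) auto
    fix s assume s: "s \<noteq> Inf ?S"
    show "j \<in> active I x s \<longleftrightarrow> release I j \<le> s \<and> s < Inf ?S"
    proof (cases "s < Inf ?S")
      case True
      then have "s \<notin> ?S" using cInf_lower[OF _ bdd, of s] by (auto simp only: not_less[symmetric])
      then show ?thesis using True j by (auto simp: active_def)
    next
      case False
      then obtain u where u: "u \<in> ?S" "u < s"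
        using s cInf_less_iff[OF ne bdd, of s] by auto
      then have "elapsed x j u \<le> elapsed x j s"
        using release_nonneg[OF j] by (intro elapsed_mono[OF j]) auto
      then show ?thesis using u False by (auto simp: active_def remaining_def)
    qed
  qed
qed

lemma completion_time_infinite:
  assumes "\<And>t. release I j \<le> t \<Longrightarrow> 0 < remaining I x j t"
  shows "completion_time I x j = \<infinity>"
proof -
  have "{t. release I j \<le> t \<and> remaining I x j t \<le> 0} = {}"
  proof (intro equals0I)
    fix t assume "t \<in> {t. release I j \<le> t \<and> remaining I x j t \<le> 0}"
    with assms[of t] show False by simp
  qed
  then show ?thesis 
    unfolding completion_time_def by (simp only: image_empty Inf_empty top_ereal_def)
qed

text \<open>Each job contributes the length of its interval from release to completion. Exchanging
  the sum over jobs with the integral counts the active jobs, except possibly at the finitely many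
  completion times.\<close>

lemma flow_time_eq_integral_active:
  assumes c: "\<And>j. j \<in> jobs I \<Longrightarrow> completion_time I x j = ereal (c j)"
      "\<And>j. j \<in> jobs I \<Longrightarrow> release I j \<le> c j" "\<And>j. j \<in> jobs I \<Longrightarrow> c j \<le> \<tau>"
    and act: "\<And>j s. j \<in> jobs I \<Longrightarrow> s \<noteq> c j \<Longrightarrow> j \<in> active I x s \<longleftrightarrow> release I j \<le> s \<and> s < c j"
  obtains F where "total_flow_time I x = ereal F"
    "((\<lambda>s. real (card (active I x s))) has_integral F) {0..\<tau>}"
proof (rule that)
  let ?F = "\<Sum>j\<in>jobs I. c j - release I j"
  show "total_flow_time I x = ereal ?F"
    unfolding total_flow_time_def by (simp add: c(1) cong: sum.cong)
  have "((\<lambda>s. \<Sum>j\<in>jobs I. if s \<in> {release I j..c j} then 1 else 0) has_integral ?F) {0..\<tau>}"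
  proof (rule has_integral_sum[OF finite_jobs])
    fix j assume j: "j \<in> jobs I"
    have "((\<lambda>_. 1::real) has_integral c j - release I j) {release I j..c j}"
      using has_integral_const_real[of "1::real" "release I j" "c j"] c(2)[OF j] by simp
    then show "((\<lambda>s. if s \<in> {release I j..c j} then 1 else 0) has_integral c j - release I j) {0..\<tau>}"
      using has_integral_restrict_closed_subinterval[of "\<lambda>_. 1::real" "c j - release I j" "release I j" "c j" 0 \<tau>]
        release_nonneg[OF j] c(3)[OF j] by (simp only: cbox_interval atLeastatMost_subset_iff simp_thms)
  qed
  moreover have "real (card (active I x s)) = (\<Sum>j\<in>jobs I. if s \<in> {release I j..c j} then 1 else 0)"
    if s: "s \<in> {0..\<tau>} - c ` jobs I" for s
  proof -
    have "j \<in> active I x s \<longleftrightarrow> s \<in> {release I j..c j}" if j: "j \<in> jobs I" for j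
    proof -
      have "s \<noteq> c j" using s j by blast
      then show ?thesis using act[OF j, of s] by auto
    qed
    then have "active I x s = {j \<in> jobs I. s \<in> {release I j..c j}}"
      by (auto simp: active_def)
    then have "real (card (active I x s)) = (\<Sum>j | j \<in> jobs I \<and> s \<in> {release I j..c j}. 1)"
      by simp
    also have "\<dots> = (\<Sum>j\<in>jobs I. if s \<in> {release I j..c j} then 1 else 0)"
      by (rule sum.inter_filter[OF finite_jobs])
    finally show ?thesis .
  qed
  ultimately show "((\<lambda>s. real (card (active I x s))) has_integral ?F) {0..\<tau>}"
    by (rule has_integral_spike_finite[OF finite_imageI[OF finite_jobs], rotated])
qed

end

section \<open>Instantaneous behaviour of SLF\<close>

locale SLF_run = feasible_schedule I x for I :: "'j job_instance" and x +
  fixes \<epsilon> :: real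
  assumes eps_pos: "0 < \<epsilon>" and eps_le_1: "\<epsilon> \<le> 1"
    and run: "policy_run \<epsilon> (SLF \<epsilon>) I x"
begin

text \<open>The estimate is read off the schedule rather than the visible queue, so it also makes
  sense for jobs that are not active. On active jobs it agrees with \<open>estimate\<close>.\<close>

definition est :: "'j \<Rightarrow> real \<Rightarrow> real" where
  "est j s = (if remaining I x j s \<le> \<epsilon> * proc I j then remaining I x j s
     else \<epsilon> / (1 - \<epsilon>) * elapsed x j s)"

lemma finite_active: "finite (active I x s)"
  using finite_jobs by (simp add: active_def)

lemma estimate_queue_at: "j \<in> active I x s \<Longrightarrow> estimate \<epsilon> (queue_at \<epsilon> I x s) j = est j s"
  by (simp add: estimate_def queue_at_def est_def remaining_def)

lemma dom_queue_at: "dom (queue_at \<epsilon> I x s) = active I x s"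
  by (auto simp: queue_at_def split: if_splits)

lemma known_jobs_queue_at:
  "known_jobs (queue_at \<epsilon> I x s) = {j \<in> active I x s. remaining I x j s \<le> \<epsilon> * proc I j}"
  by (auto simp: known_jobs_def queue_at_def)

lemma unknown_jobs_queue_at:
  "unknown_jobs (queue_at \<epsilon> I x s) = {j \<in> active I x s. \<not> remaining I x j s \<le> \<epsilon> * proc I j}"
  by (auto simp: unknown_jobs_def queue_at_def)

text \<open>Turns membership in the policy into a case rule. In both cases the comparison of the two
  minima upgrades minimality within one class to minimality among all active jobs.\<close>

lemma SLF_step:
  assumes s: "0 \<le> s" and ne: "active I x s \<noteq> {}"
  obtains
    (known) l where "l \<in> active I x s" "remaining I x l s \<le> \<epsilon> * proc I l"
      "\<And>i. i \<in> active I x s \<Longrightarrow> est l s \<le> est i s"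
      "\<And>i. x i s = equal_pace {l} i"
  | (unknown) U where "U \<noteq> {}" "U \<subseteq> active I x s"
      "\<And>i j. j \<in> U \<Longrightarrow> i \<in> active I x s \<Longrightarrow> est j s \<le> est i s"
      "\<And>j. j \<in> U \<Longrightarrow> \<not> remaining I x j s \<le> \<epsilon> * proc I j"
      "\<And>i. x i s = equal_pace U i"
proof -
  let ?Q = "queue_at \<epsilon> I x s"
  let ?K = "known_jobs ?Q" and ?U = "unknown_jobs ?Q"
  have split: "active I x s = ?K \<union> ?U"
    by (auto simp: known_jobs_queue_at unknown_jobs_queue_at)
  have est: "estimate \<epsilon> ?Q j = est j s" if "j \<in> ?K \<or> j \<in> ?U" for j
    using that split by (intro estimate_queue_at) auto
  have mem: "(\<lambda>j. x j s) \<in> SLF \<epsilon> ?Q" using run s by (simp add: policy_run_def)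
  show thesis
  proof (cases "min_estimate \<epsilon> ?Q ?K \<le> min_estimate \<epsilon> ?Q ?U")
    case True
    then obtain l where l: "l \<in> min_estimate_jobs \<epsilon> ?Q ?K" and rate: "(\<lambda>j. x j s) = equal_pace {l}"
      using mem ne by (auto simp: SLF_def dom_queue_at)
    have least: "est l s \<le> est i s" if "i \<in> ?K" for i
      using l that est by (auto simp: min_estimate_jobs_def is_arg_min_linorder)
    have lK: "l \<in> ?K" using l by (auto simp: min_estimate_jobs_def is_arg_min_def)
    have "est l s \<le> est i s" if i: "i \<in> ?U" for i
    proof -
      have "ereal (est l s) \<le> min_estimate \<epsilon> ?Q ?K"
        unfolding min_estimate_def by (rule INF_greatest) (simp add: est least)
      also have "\<dots> \<le> min_estimate \<epsilon> ?Q ?U" by (fact True)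
      also have "\<dots> \<le> ereal (est i s)"
        unfolding min_estimate_def by (rule INF_lower2[OF i]) (simp add: est i)
      finally show ?thesis by simp
    qed
    then have "\<And>i. i \<in> active I x s \<Longrightarrow> est l s \<le> est i s" using least split by auto
    then show thesis
      by (intro known[of l]) (use lK fun_cong[OF rate] in \<open>auto simp: known_jobs_queue_at\<close>)
  next
    case False
    let ?V = "min_estimate_jobs \<epsilon> ?Q ?U"
    have rate: "(\<lambda>j. x j s) = equal_pace ?V"
      using mem ne False by (auto simp: SLF_def dom_queue_at)
    have V: "j \<in> ?V \<longleftrightarrow> j \<in> ?U \<and> (\<forall>i\<in>?U. est j s \<le> est i s)" for j
      using est by (auto simp: min_estimate_jobs_def is_arg_min_linorder)
    \<comment> \<open>Without unknown jobs their minimum estimate would be \<infinity>, and the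
      comparison could not fail.\<close>
    have "?U \<noteq> {}" using False by (auto simp: min_estimate_def)
    moreover have "finite ?U" using split finite_active[of s] by auto
    ultimately obtain v where "v \<in> ?U" "\<forall>i\<in>?U. est v s \<le> est i s"
      using ex_min_if_finite[of "(\<lambda>i. est i s) ` ?U"] by (auto simp: not_less)
    then have "?V \<noteq> {}" using V by blast
    moreover have "est j s \<le> est i s" if j: "j \<in> ?V" and i: "i \<in> active I x s" for i j
    proof (cases "i \<in> ?U")
      case iK: False
      then have "i \<in> ?K" using i split by auto
      have "ereal (est j s) \<le> min_estimate \<epsilon> ?Q ?U"
        unfolding min_estimate_def by (rule INF_greatest) (use j V est in auto)
      also have "\<dots> \<le> min_estimate \<epsilon> ?Q ?K" using False by simp
      also have "\<dots> \<le> ereal (est i s)"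
        unfolding min_estimate_def by (rule INF_lower2[OF \<open>i \<in> ?K\<close>]) (simp add: est \<open>i \<in> ?K\<close>)
      finally show ?thesis by simp
    qed (use j V in auto)
    moreover have "j \<in> active I x s" "\<not> remaining I x j s \<le> \<epsilon> * proc I j" if "j \<in> ?V" for j
      using that V[of j] unknown_jobs_queue_at[of s] by auto
    ultimately show thesis using fun_cong[OF rate] by (intro unknown[of ?V]) blast+
  qed
qed

lemma rate_sum_eq_1:
  assumes s: "0 \<le> s" and ne: "active I x s \<noteq> {}"
  shows "(\<Sum>j\<in>jobs I. x j s) = 1"
proof -
  have pace: "(\<Sum>j\<in>jobs I. equal_pace U j) = 1" if "U \<noteq> {}" "U \<subseteq> jobs I" for U
  proof -
    have "finite U" using that finite_jobs finite_subset by blast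
    then show ?thesis
      using that finite_jobs by (simp add: equal_pace_def sum.If_cases Int_absorb1)
  qed
  from s ne show ?thesis
  proof (cases rule: SLF_step)
    case (known l)
    then show ?thesis using pace[of "{l}"] by (auto simp: active_def)
  next
    case (unknown U)
    then show ?thesis using pace[of U] by (auto simp: active_def)
  qed
qed

lemma processed_least_est:
  assumes s: "0 \<le> s" and j: "x j s \<noteq> 0" and i: "i \<in> active I x s"
  shows "est j s \<le> est i s"
proof -
  have "active I x s \<noteq> {}" using i by blast
  with s show ?thesis
    by (cases rule: SLF_step) (use i j in \<open>auto simp: equal_pace_def split: if_splits\<close>)
qed

lemma known_processed_alone:
  assumes s: "0 \<le> s" and l: "l \<in> active I x s" and j: "x l s \<noteq> 0"
    and known: "remaining I x l s \<le> \<epsilon> * proc I l" and "i \<noteq> l"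
  shows "x i s = 0"
proof -
  have "active I x s \<noteq> {}" using l by blast
  with s show ?thesis
    by (cases rule: SLF_step) (use assms in \<open>auto simp: equal_pace_def split: if_splits\<close>)
qed

section \<open>Estimates against remaining and elapsed time\<close>

text \<open>A job is known exactly if \<open>(1 - \<epsilon>) * r \<le> \<epsilon> * e\<close>, so
  for \<open>\<epsilon> < 1\<close> the estimate is the smaller of \<open>r\<close> and
  \<open>\<epsilon> / (1 - \<epsilon>) * e\<close>. The second bound is stated without division to
  cover \<open>\<epsilon> = 1\<close>; as elapsed time only grows, it persists.\<close>

lemma est_geD:
  assumes j: "j \<in> jobs I" and s: "0 \<le> s" and \<theta>: "\<theta> \<le> est j s"
  shows "\<theta> \<le> remaining I x j s" "(1 - \<epsilon>) * \<theta> \<le> \<epsilon> * elapsed x j s"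
proof -
  let ?e = "elapsed x j s" and ?r = "remaining I x j s"
  have p: "proc I j = ?e + ?r" by (simp add: remaining_def)
  have "\<theta> \<le> ?r \<and> (1 - \<epsilon>) * \<theta> \<le> \<epsilon> * ?e"
  proof (cases "?r \<le> \<epsilon> * proc I j")
    case True
    then have "(1 - \<epsilon>) * ?r \<le> \<epsilon> * ?e" by (simp add: p algebra_simps)
    moreover have "\<theta> \<le> ?r" using True \<theta> by (simp add: est_def)
    moreover from this have "(1 - \<epsilon>) * \<theta> \<le> (1 - \<epsilon>) * ?r"
      using eps_le_1 by (intro mult_left_mono) auto
    ultimately show ?thesis by simp
  next
    case False
    then have less: "\<epsilon> * ?e < (1 - \<epsilon>) * ?r" by (simp add: p algebra_simps)
    \<comment> \<open>For \<open>\<epsilon> = 1\<close> an unknown job would have negative elapsed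
      time.\<close>
    have "\<epsilon> \<noteq> 1" using less elapsed_nonneg[OF j s] by auto
    then have eps: "0 < 1 - \<epsilon>" using eps_le_1 by simp
    have "(1 - \<epsilon>) * \<theta> \<le> \<epsilon> * ?e"
      using \<theta> False eps by (simp add: est_def field_simps)
    moreover from this less have "(1 - \<epsilon>) * \<theta> < (1 - \<epsilon>) * ?r" by simp
    ultimately show ?thesis using eps by simp
  qed
  then show "\<theta> \<le> ?r" "(1 - \<epsilon>) * \<theta> \<le> \<epsilon> * ?e" by auto
qed

text \<open>Enough elapsed time for the level \<theta> guarantees that the job has been revealed by
  the time its remaining time is down to \<theta>.\<close>

lemma est_known:
  assumes "(1 - \<epsilon>) * \<theta> \<le> \<epsilon> * elapsed x j s" "remaining I x j s \<le> \<theta>"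
  shows "remaining I x j s \<le> \<epsilon> * proc I j" "est j s = remaining I x j s"
proof -
  have "(1 - \<epsilon>) * remaining I x j s \<le> (1 - \<epsilon>) * \<theta>"
    using assms eps_le_1 by (intro mult_left_mono) auto
  then show "remaining I x j s \<le> \<epsilon> * proc I j"
    using assms by (simp add: remaining_def algebra_simps)
  then show "est j s = remaining I x j s" by (simp add: est_def)
qed

text \<open>A converse to \<open>est_geD\<close>. The minimum appears because the remaining time may
  already be below \<theta>.\<close>

lemma est_ge:
  assumes j: "j \<in> jobs I" and s: "0 \<le> s" and e: "(1 - \<epsilon>) * \<theta> \<le> \<epsilon> * elapsed x j s"
  shows "min \<theta> (remaining I x j s) \<le> est j s"
proof (cases "remaining I x j s \<le> \<epsilon> * proc I j")
  case False
  have "\<epsilon> \<noteq> 1" using False elapsed_nonneg[OF j s] by (auto simp: remaining_def)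
  then have "0 < 1 - \<epsilon>" using eps_le_1 by simp
  then have "\<theta> \<le> \<epsilon> / (1 - \<epsilon>) * elapsed x j s" using e by (simp add: field_simps)
  then show ?thesis using False by (simp add: est_def)
qed (simp add: est_def)

lemma est_gt:
  assumes j: "j \<in> jobs I" and s: "0 \<le> s"
    and e: "(1 - \<epsilon>) * \<theta> < \<epsilon> * elapsed x j s" and r: "\<theta> < remaining I x j s"
  shows "\<theta> < est j s"
proof (cases "remaining I x j s \<le> \<epsilon> * proc I j")
  case False
  have "\<epsilon> \<noteq> 1" using False elapsed_nonneg[OF j s] by (auto simp: remaining_def)
  then have "0 < 1 - \<epsilon>" using eps_le_1 by simp
  then have "\<theta> < \<epsilon> / (1 - \<epsilon>) * elapsed x j s" using e by (simp add: field_simps)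
  then show ?thesis using False by (simp add: est_def)
qed (use r in \<open>simp add: est_def\<close>)

text \<open>Two known jobs of equal remaining time cannot shrink simultaneously, because only one of
  them is processed at any instant.\<close>

lemma at_most_one_falls_below:
  assumes l: "l \<in> jobs I" "l' \<in> jobs I" "l \<noteq> l'"
    and st: "0 \<le> s" "s \<le> t" and rel: "release I l \<le> s" "release I l' \<le> s"
    and above: "\<theta> < est l s" "\<theta> < est l' s"
    and below: "remaining I x l t \<le> \<theta>" "remaining I x l' t \<le> \<theta>"
    and act: "0 < remaining I x l t" "0 < remaining I x l' t"
  shows False
proof -
  let ?r = "remaining I x"
  \<comment> \<open>At \<open>s\<close> both jobs have estimate at least \<open>\<theta>'\<close>.
    The resulting bound on elapsed time persists, so from \<open>s\<close> on each of them is known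
    as soon as its remaining time is at most \<open>\<theta>'\<close>.\<close>
  define \<theta>' where "\<theta>' = min (est l s) (est l' s)"
  have \<theta>': "\<theta> < \<theta>'" using above by (simp add: \<theta>'_def)
  have high: "\<theta>' \<le> ?r a s" "(1 - \<epsilon>) * \<theta>' \<le> \<epsilon> * elapsed x a s" if "a = l \<or> a = l'" for a
    using est_geD[of a s \<theta>'] that l st by (auto simp: \<theta>'_def)
  have high': "(1 - \<epsilon>) * \<theta>' \<le> \<epsilon> * elapsed x a u" if "a = l \<or> a = l'" "s \<le> u" for a u
  proof -
    have "\<epsilon> * elapsed x a s \<le> \<epsilon> * elapsed x a u"
      using that l st eps_pos by (intro mult_left_mono elapsed_mono) auto
    with high(2)[OF that(1)] show ?thesis by simp
  qed
  have active: "a \<in> active I x u" if "a = l \<or> a = l'" "s \<le> u" "u \<le> t" for a u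
    using that l st rel act remaining_antimono[of a u t] by (auto simp: active_def)
  \<comment> \<open>Below \<open>\<theta>'\<close> job \<open>a\<close> is known with estimate equal
    to its remaining time, while the estimate of \<open>b\<close> is strictly larger. SLF therefore
    does not process \<open>b\<close>.\<close>
  have blocked: "x b u = 0"
    if ab: "a = l \<or> a = l'" "b = l \<or> b = l'" and u: "s \<le> u" "u \<le> t"
      and less: "?r a u < \<theta>'" "?r a u < ?r b u" for a b u
  proof (rule ccontr)
    assume "x b u \<noteq> 0"
    then have "est b u \<le> est a u"
      using processed_least_est[of u b a] active[OF ab(1) u] st u by auto
    also have "\<dots> = ?r a u" using est_known(2)[OF high'[OF ab(1) u(1)]] less by simp
    finally have "est b u \<le> ?r a u" .
    moreover have "min \<theta>' (?r b u) \<le> est b u"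
      using est_ge[OF _ _ high'[OF ab(2) u(1)]] ab l st u by auto
    ultimately show False using less by simp
  qed
  \<comment> \<open>If \<open>a\<close> is ahead, then \<open>b\<close> stays blocked until its
    remaining time comes down to that of \<open>a\<close> at \<open>u\<close>. It never moves, and
    so cannot reach \<theta> by time \<open>t\<close>.\<close>
  have ahead: "\<not> (?r a u < \<theta>' \<and> ?r a u < ?r b u)"
    if ab: "a = l \<or> a = l'" "b = l \<or> b = l'" and u: "s \<le> u" "u \<le> t" and gt: "\<theta> < ?r b u" for a b u
  proof
    assume less: "?r a u < \<theta>' \<and> ?r a u < ?r b u"
    have "elapsed x b t = elapsed x b u"
    proof (rule elapsed_stuck[where c = "elapsed x b u" and d = "proc I b - ?r a u"])
      fix v assume v: "u < v" "v < t" "elapsed x b v < proc I b - ?r a u"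
      have "?r a v \<le> ?r a u" using v u st l ab by (intro remaining_antimono) auto
      with v less show "x b v = 0"
        using u by (intro blocked[OF ab]) (auto simp: remaining_def[of I x b])
    qed (use ab l st u less in \<open>auto simp: remaining_def[of I x b]\<close>)
    then have "?r b t = ?r b u" by (simp add: remaining_def)
    with gt below ab show False by auto
  qed
  have tie: "?r l' u = ?r l u" if u: "s \<le> u" "u \<le> t" and r: "\<theta> < ?r l u" "?r l u < \<theta>'" for u
    using ahead[of l' l u] ahead[of l l' u] u r by auto
  \<comment> \<open>Two levels strictly inside the band between \<theta> and
    \<open>\<theta>'\<close>, where the two remaining times coincide by \<open>tie\<close>.\<close>
  define y z where "y = (\<theta> + 3 * \<theta>') / 4" and "z = (\<theta> + \<theta>') / 2"
  have yz: "\<theta> < z" "z < y" "y < \<theta>'" using \<theta>' by (auto simp: y_def z_def)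
  obtain u where u: "s \<le> u" "u \<le> t" "elapsed x l u = proc I l - y"
    using elapsed_IVT[OF l(1) st, of "proc I l - y"] yz high(1)[of l] below
    by (auto simp: remaining_def)
  obtain v where v: "u \<le> v" "v \<le> t" "elapsed x l v = proc I l - z"
    using elapsed_IVT[of l u t "proc I l - z"] u yz below l st
    by (auto simp: remaining_def)
  have between: "\<theta> < ?r l w \<and> ?r l w < \<theta>' \<and> ?r l' w = ?r l w" if w: "u \<le> w" "w \<le> v" for w
  proof -
    have "?r l w \<le> ?r l u" "?r l v \<le> ?r l w"
      using w u v st by (auto intro!: remaining_antimono l)
    then have "\<theta> < ?r l w" "?r l w < \<theta>'" using u v yz by (auto simp: remaining_def)
    with tie[of w] w u v show ?thesis by auto
  qed
  \<comment> \<open>Equal remaining times give equal work on every subinterval, yet the two known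
    jobs are never processed together. Hence neither progresses, although \<open>l\<close> falls
    from \<open>y\<close> to \<open>z\<close>.\<close>
  have "integral {u..v} (x l) = 0"
  proof (rule disjoint_rates_equal_integrals_zero)
    show "x l integrable_on {u..v}" "x l' integrable_on {u..v}"
      using l st u by (auto intro: rate_integrable)
    fix w assume w: "w \<in> {u..v}"
    then show "0 \<le> x l w" "0 \<le> x l' w" using l st u by (auto intro: rate_nonneg)
    have "x l' w = 0" if "x l w \<noteq> 0"
    proof (rule known_processed_alone[of w l])
      show "?r l w \<le> \<epsilon> * proc I l"
        using between[of w] w u by (intro est_known(1)[OF high'[of l w]]) auto
    qed (use that w u v st active[of l w] l in auto)
    then show "x l w = 0 \<or> x l' w = 0" by blast
  next
    fix a b assume ab: "u \<le> a" "a \<le> b" "b \<le> v"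
    show "integral {a..b} (x l) = integral {a..b} (x l')"
      using between[of a] between[of b] ab elapsed_diff[of l a b] elapsed_diff[of l' a b] l st u
      by (auto simp: remaining_def)
  qed
  then have "elapsed x l v = elapsed x l u" using elapsed_diff[of l u v] l st u v by auto
  with u v yz show False by simp
qed

section \<open>The potential argument\<close>

text \<open>The release time is strictly before \<open>t\<close>, unlike in \<open>active\<close>,
  so a job released exactly at the start of a phase counts as a new arrival of that phase.\<close>

definition pending :: "real \<Rightarrow> 'j set" where
  "pending t = {j \<in> jobs I. release I j < t \<and> 0 < remaining I x j t}"

text \<open>While only jobs of estimate at most \<open>\<theta>\<close> are processed, a job pending at the start
  receives at most \<open>\<theta>\<close> units of work, and only by being brought to completion, whereas a newly
  arrived one receives at most \<open>\<theta> / \<epsilon>\<close> units.\<close>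

lemma potential_step:
  assumes \<theta>: "0 \<le> \<theta>" and t0: "0 \<le> t0" "t0 \<le> t" and M: "M \<subseteq> jobs I"
    and busy: "\<And>s. t0 < s \<Longrightarrow> s < t \<Longrightarrow> active I x s \<noteq> {}"
    and low: "\<And>s j. t0 < s \<Longrightarrow> s < t \<Longrightarrow> x j s \<noteq> 0 \<Longrightarrow> est j s \<le> \<theta>"
    and old: "\<And>j. j \<in> pending t0 \<Longrightarrow> \<theta> \<le> remaining I x j t0"
      "\<And>j. j \<in> pending t0 \<Longrightarrow> (1 - \<epsilon>) * \<theta> \<le> \<epsilon> * elapsed x j t0"
  shows "(\<Sum>j | j \<in> jobs I \<and> release I j < t. min \<theta> (remaining I x j t)) + (t - t0)
    \<le> real (card (pending t0)) * \<theta> + real (card {j \<in> M. t0 \<le> release I j \<and> release I j < t}) * (\<theta> / \<epsilon>)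
      + (\<Sum>j | j \<in> jobs I - M \<and> t0 \<le> release I j \<and> release I j < t. proc I j)"
proof -
  let ?e = "elapsed x" and ?r = "remaining I x"
  let ?\<rho> = "\<lambda>j. min \<theta> (?r j t)" and ?w = "\<lambda>j. ?e j t - ?e j t0"
  let ?M = "{j \<in> M. t0 \<le> release I j \<and> release I j < t}"
  let ?N = "{j. j \<in> jobs I - M \<and> t0 \<le> release I j \<and> release I j < t}"
  \<comment> \<open>For \<open>\<epsilon> < 1\<close> this is the elapsed time at which an unknown
    job has estimate \<theta>; for \<open>\<epsilon> = 1\<close> it is 0. With elapsed time strictly
    between \<open>c\<close> and \<open>proc I j - \<theta>\<close> the estimate exceeds \<theta>,
    so the job gets no work in this phase.\<close>
  define c where "c = (1 - \<epsilon>) * \<theta> / \<epsilon>"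
  have c: "0 \<le> c" using \<theta> eps_pos eps_le_1 by (simp add: c_def)
  have c_eq: "c = \<theta> / \<epsilon> - \<theta>" using eps_pos by (simp add: c_def field_simps)
  have idle: "x j s = 0"
    if "t0 < s" "s < t" "c < ?e j s" "?e j s < proc I j - \<theta>" "j \<in> jobs I" for j s
  proof -
    have "(1 - \<epsilon>) * \<theta> < \<epsilon> * ?e j s" using that eps_pos by (simp add: c_def field_simps)
    then have "\<theta> < est j s" using that t0 by (intro est_gt) (auto simp: remaining_def)
    then show ?thesis using low[OF that(1,2), of j] by (meson not_less)
  qed
  have stuck: "?e j t = ?e j u"
    if "j \<in> jobs I" "t0 \<le> u" "u \<le> t" "c \<le> ?e j u" "?e j u < proc I j - \<theta>" for j u
  proof (rule elapsed_stuck[where c = c and d = "proc I j - \<theta>"])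
    fix s assume "u < s" "s < t" "c < ?e j s" "?e j s < proc I j - \<theta>"
    then show "x j s = 0" using that by (intro idle) simp_all
  qed (use that t0 in simp_all)
  \<comment> \<open>An old job with remaining time above \<theta> is stuck. Otherwise its remaining
    time at \<open>t0\<close> is exactly \<theta>, and work plus what is left adds up to
    \<theta>.\<close>
  have w_old: "?w j \<le> \<theta> - ?\<rho> j" if j: "j \<in> pending t0" for j
  proof (cases "?e j t0 < proc I j - \<theta>")
    case True
    have "c \<le> ?e j t0" using old(2)[OF j] eps_pos by (simp add: c_def field_simps)
    then have "?e j t = ?e j t0" using True j t0 by (intro stuck) (auto simp: pending_def)
    then show ?thesis by simp
  next
    case False
    then show ?thesis using old(1)[OF j] by (auto simp: remaining_def)
  qed
  \<comment> \<open>A job of size at most \<open>\<theta> / \<epsilon>\<close> contributes at most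
    its size. For a larger one \<open>c\<close> lies below \<open>proc I j - \<theta>\<close>, so
    its work stops at \<open>c\<close>, which is
    \<open>\<theta> / \<epsilon> - \<theta>\<close>.\<close>
  have w_M: "?w j \<le> \<theta> / \<epsilon> - ?\<rho> j" if j: "j \<in> ?M" for j
  proof -
    have jobs: "j \<in> jobs I" using j M by auto
    have e0: "?e j t0 = 0" using j jobs t0 by (intro elapsed_before_release) auto
    show ?thesis
    proof (cases "proc I j \<le> \<theta> / \<epsilon>")
      case True
      then show ?thesis using e0 by (auto simp: remaining_def min_def)
    next
      case False
      have "?e j t \<le> c"
      proof (rule ccontr)
        assume less: "\<not> ?e j t \<le> c"
        then obtain u where u: "t0 \<le> u" "u \<le> t" "?e j u = c"
          using elapsed_IVT[OF jobs t0, of c] e0 c by auto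
        have "?e j t = ?e j u" using u False jobs c_eq by (intro stuck) auto
        with u less show False by simp
      qed
      then show ?thesis using e0 c_eq by (auto simp: min_def)
    qed
  qed
  have w_N: "?w j \<le> proc I j - ?\<rho> j" if j: "j \<in> ?N" for j
    using elapsed_before_release[of j t0] t0 j by (auto simp: remaining_def)
  \<comment> \<open>The remaining jobs were finished by \<open>t0\<close> or are not released before
    \<open>t\<close>.\<close>
  have rest: "?w j \<le> 0" if j: "j \<in> jobs I" "j \<notin> pending t0" "j \<notin> ?M" "j \<notin> ?N" for j
  proof (cases "release I j < t0")
    case True
    then show ?thesis using j elapsed_le_proc[of j t] t0 by (auto simp: pending_def remaining_def)
  next
    case False
    then show ?thesis
      using j elapsed_before_release[of j t] elapsed_nonneg[of j t0] t0 by auto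
  qed
  have rho_rest: "?\<rho> j \<le> 0"
    if j: "j \<in> jobs I" "release I j < t" "j \<notin> pending t0" "j \<notin> ?M" "j \<notin> ?N" for j
    using j remaining_antimono[of j t0 t] t0 by (auto simp: pending_def min_def)
  have fin: "finite (pending t0)" "finite ?M" "finite ?N"
    using finite_jobs M finite_subset[OF M] by (auto simp: pending_def)
  have disj: "pending t0 \<inter> (?M \<union> ?N) = {}" "?M \<inter> ?N = {}" by (auto simp: pending_def)
  let ?P = "pending t0 \<union> (?M \<union> ?N)"
  have sub: "?P \<subseteq> jobs I" using M by (auto simp: pending_def)
  have sub': "?P \<subseteq> {j. j \<in> jobs I \<and> release I j < t}" and
    finite_released: "finite {j. j \<in> jobs I \<and> release I j < t}"
    using sub t0 finite_jobs by (auto simp: pending_def)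
  have split: "sum f ?P = sum f (pending t0) + (sum f ?M + sum f ?N)" for f :: "'j \<Rightarrow> real"
    using fin disj by (simp add: sum.union_disjoint)
  have "t - t0 = (\<Sum>j\<in>jobs I. ?w j)"
  proof (rule work_eq[OF t0, symmetric])
    fix s assume s: "t0 < s" "s < t"
    show "(\<Sum>j\<in>jobs I. x j s) = 1"
      by (rule rate_sum_eq_1[OF _ busy[OF s]]) (use s t0 in simp)
  qed
  also have "\<dots> = sum ?w ?P + sum ?w (jobs I - ?P)"
    using sum.subset_diff[OF sub finite_jobs, of ?w] by (simp only: add.commute)
  also have "sum ?w (jobs I - ?P) \<le> 0" by (rule sum_nonpos, rule rest) blast+
  finally have work: "t - t0 \<le> sum ?w ?P" by simp
  have "(\<Sum>j | j \<in> jobs I \<and> release I j < t. ?\<rho> j)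
      = sum ?\<rho> ?P + sum ?\<rho> ({j. j \<in> jobs I \<and> release I j < t} - ?P)"
    using sum.subset_diff[OF sub' finite_released, of ?\<rho>] by (simp only: add.commute)
  also have "sum ?\<rho> ({j. j \<in> jobs I \<and> release I j < t} - ?P) \<le> 0"
    by (rule sum_nonpos, rule rho_rest) blast+
  finally have "(\<Sum>j | j \<in> jobs I \<and> release I j < t. ?\<rho> j) + (t - t0) \<le> (\<Sum>j\<in>?P. ?w j + ?\<rho> j)"
    using work by (simp add: sum.distrib)
  also have "\<dots> \<le> (\<Sum>j\<in>pending t0. \<theta>) + ((\<Sum>j\<in>?M. \<theta> / \<epsilon>) + (\<Sum>j\<in>?N. proc I j))"
    unfolding split using w_old w_M w_N by (intro add_mono sum_mono) (auto simp: le_diff_eq)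
  finally show ?thesis by simp
qed

lemma finite_pending: "finite (pending t)"
  using finite_jobs by (simp add: pending_def)

text \<open>At a busy moment when SLF processes a job of estimate above \<theta>, all active jobs
  have estimate at least \<theta>. The supremum of the idle and high moments need not be one itself,
  so the bounds are carried to it: remaining times shrink at rate at most 1, and elapsed times only
  grow.\<close>

lemma last_high_time:
  assumes a: "0 \<le> a" "a < t"
    and busy: "\<And>s. a < s \<Longrightarrow> s < t \<Longrightarrow> active I x s \<noteq> {}"
    and low: "\<And>s j. a < s \<Longrightarrow> s < t \<Longrightarrow> x j s \<noteq> 0 \<Longrightarrow> est j s \<le> \<theta>"
  obtains t0 where "0 \<le> t0" "t0 \<le> a"
    "\<And>s. t0 < s \<Longrightarrow> s < t \<Longrightarrow> active I x s \<noteq> {}"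
    "\<And>s j. t0 < s \<Longrightarrow> s < t \<Longrightarrow> x j s \<noteq> 0 \<Longrightarrow> est j s \<le> \<theta>"
    "\<And>j. j \<in> pending t0 \<Longrightarrow> \<theta> \<le> remaining I x j t0"
    "\<And>j. j \<in> pending t0 \<Longrightarrow> (1 - \<epsilon>) * \<theta> \<le> \<epsilon> * elapsed x j t0"
proof -
  define Z where "Z = {s. 0 \<le> s \<and> s < t \<and> (active I x s = {} \<or> (\<exists>j. x j s \<noteq> 0 \<and> \<theta> < est j s))}"
  \<comment> \<open>Inserting 0 gives the default start if there is no idle or high moment; no job
    is pending at time 0.\<close>
  define t0 where "t0 = Sup (insert 0 Z)"
  have Z_le: "s \<le> a" if "s \<in> insert 0 Z" for s
  proof (rule ccontr)
    assume "\<not> s \<le> a"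
    then have s: "a < s" "s \<in> Z" using that a by auto
    then have "s < t" "active I x s = {} \<or> (\<exists>j. x j s \<noteq> 0 \<and> \<theta> < est j s)"
      by (simp_all add: Z_def)
    with busy[OF s(1)] low[OF s(1)] show False by (meson not_less)
  qed
  then have bdd: "bdd_above (insert 0 Z)" by (auto simp: bdd_above_def)
  have Z_le_t0: "s \<le> t0" if "s \<in> insert 0 Z" for s
    unfolding t0_def using that bdd by (rule cSup_upper)
  have "t0 \<le> a" unfolding t0_def by (rule cSup_least) (use Z_le in auto)
  have "0 \<le> t0" using Z_le_t0 by simp
  have notZ: "s \<notin> Z" if "t0 < s" for s using Z_le_t0[of s] that by auto
  \<comment> \<open>A job pending at \<open>t0\<close> is active at moments of \<open>Z\<close>
    after its release, so these are not idle and must be high. They exist arbitrarily close to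
    \<open>t0\<close> or at \<open>t0\<close> itself.\<close>
  have near: "\<exists>s. b < s \<and> s \<le> t0 \<and> \<theta> \<le> remaining I x j s \<and> (1 - \<epsilon>) * \<theta> \<le> \<epsilon> * elapsed x j s"
    if j: "j \<in> pending t0" and b: "release I j \<le> b" "b < t0" for j b
  proof -
    have jobs: "j \<in> jobs I" using j by (simp add: pending_def)
    obtain s where s: "s \<in> insert 0 Z" "b < s"
      using b less_cSup_iff[OF _ bdd, of b] by (auto simp: t0_def)
    have "0 \<le> b" using release_nonneg[OF jobs] b by simp
    then have sZ: "s \<in> Z" and s0: "0 \<le> s" using s by auto
    have st0: "s \<le> t0" using Z_le_t0 s by auto
    have act: "j \<in> active I x s"
      using j b s remaining_antimono[OF jobs s0 st0] by (auto simp: active_def pending_def)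
    then obtain i where "x i s \<noteq> 0" "\<theta> < est i s" using sZ by (auto simp: Z_def)
    then have "\<theta> \<le> est j s" using processed_least_est[OF s0 _ act, of i] by simp
    from est_geD[OF jobs s0 this] show ?thesis using s st0 by blast
  qed
  show thesis
  proof (rule that[of t0])
    show "0 \<le> t0" "t0 \<le> a" by fact+
    show "active I x s \<noteq> {}" if "t0 < s" "s < t" for s
      using notZ[OF that(1)] that \<open>0 \<le> t0\<close> by (auto simp: Z_def)
    show "est j s \<le> \<theta>" if "t0 < s" "s < t" "x j s \<noteq> 0" for s j
    proof (rule ccontr)
      assume "\<not> ?thesis"
      then have "s \<in> Z" using that \<open>0 \<le> t0\<close> unfolding Z_def by (auto simp: not_le)
      with notZ[OF that(1)] show False ..
    qed
    fix j assume j: "j \<in> pending t0"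
    then have jobs: "j \<in> jobs I" and rel: "release I j < t0" by (auto simp: pending_def)
    have q: "0 \<le> release I j" using release_nonneg[OF jobs] .
    show "\<theta> \<le> remaining I x j t0"
    proof (rule field_le_epsilon)
      fix d :: real assume "0 < d"
      then obtain s where s: "max (release I j) (t0 - d) < s" "s \<le> t0" "\<theta> \<le> remaining I x j s"
        using near[OF j, of "max (release I j) (t0 - d)"] rel by auto
      have "elapsed x j t0 - elapsed x j s \<le> t0 - s"
        using work_le[of "{j}" s t0] jobs s q by auto
      then show "\<theta> \<le> remaining I x j t0 + d" using s by (auto simp: remaining_def)
    qed
    obtain s where s: "release I j < s" "s \<le> t0" "(1 - \<epsilon>) * \<theta> \<le> \<epsilon> * elapsed x j s"
      using near[OF j, of "release I j"] rel by auto
    have "\<epsilon> * elapsed x j s \<le> \<epsilon> * elapsed x j t0"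
      using s q jobs eps_pos by (intro mult_left_mono elapsed_mono) auto
    with s show "(1 - \<epsilon>) * \<theta> \<le> \<epsilon> * elapsed x j t0" by simp
  qed
qed

text \<open>The threshold is the second smallest remaining time at \<open>t\<close>. After
  \<open>a\<close> all pending jobs are present; processing an estimate above the threshold would
  put them all above it, and then the two smallest would both have to fall to it, contradicting
  \<open>at_most_one_falls_below\<close>.\<close>

lemma second_smallest_threshold:
  assumes t: "0 \<le> t" and ne: "pending t \<noteq> {}"
    and a: "0 \<le> a" "\<And>j. j \<in> pending t \<Longrightarrow> release I j \<le> a"
  obtains l \<theta> where "l \<in> pending t"
    "\<And>j. j \<in> pending t \<Longrightarrow> remaining I x l t \<le> remaining I x j t"
    "remaining I x l t \<le> \<theta>"
    "\<And>j. j \<in> pending t \<Longrightarrow> j \<noteq> l \<Longrightarrow> \<theta> \<le> remaining I x j t"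
    "\<And>s j. a < s \<Longrightarrow> s < t \<Longrightarrow> x j s \<noteq> 0 \<Longrightarrow> est j s \<le> \<theta>"
proof -
  let ?r = "\<lambda>j. remaining I x j t"
  have least: "\<exists>l\<in>A. \<forall>j\<in>A. ?r l \<le> ?r j" if "A \<noteq> {}" "A \<subseteq> pending t" for A
    using ex_is_arg_min_if_finite[of A ?r] finite_subset[OF that(2) finite_pending] that(1)
    by (auto simp: is_arg_min_linorder)
  have active: "j \<in> active I x s" if "j \<in> pending t" "a < s" "s < t" for j s
    using that a remaining_antimono[of j s t] by (force simp: active_def pending_def)
  have jobs: "j \<in> jobs I" if "x j s \<noteq> 0" "a < s" "s < t" for j s
  proof -
    have "active I x s \<noteq> {}" using active that ne by blast
    with a that have s: "0 \<le> s" "active I x s \<noteq> {}" by auto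
    then show ?thesis
      by (cases rule: SLF_step) (use that in \<open>auto simp: equal_pace_def active_def split: if_splits\<close>)
  qed
  obtain l where l: "l \<in> pending t" "\<forall>j\<in>pending t. ?r l \<le> ?r j"
    using least[of "pending t"] ne by auto
  show thesis
  proof (cases "pending t = {l}")
    case True
    \<comment> \<open>With a single pending job there is no second smallest value; the total
      processing time bounds every estimate that occurs.\<close>
    let ?\<theta> = "\<Sum>j\<in>jobs I. proc I j"
    have r_le: "remaining I x j s \<le> ?\<theta>" if "j \<in> jobs I" "0 \<le> s" for j s
    proof -
      have "remaining I x j s \<le> proc I j"
        using elapsed_nonneg[OF that] by (simp add: remaining_def)
      also have "\<dots> \<le> ?\<theta>"
        using that proc_pos by (intro member_le_sum finite_jobs) (auto intro: less_imp_le)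
      finally show ?thesis .
    qed
    have "est j s \<le> ?\<theta>" if "a < s" "s < t" "x j s \<noteq> 0" for s j
      using est_geD(1)[of j s "est j s"] r_le[of j s] jobs[of j s] that a by auto
    then show thesis
      by (intro that[of l ?\<theta>]) (use l True r_le[of l t] t in \<open>auto simp: pending_def\<close>)
  next
    case False
    then obtain l' where l': "l' \<in> pending t - {l}" "\<forall>j\<in>pending t - {l}. ?r l' \<le> ?r j"
      using least[of "pending t - {l}"] l by auto
    have "est j s \<le> ?r l'" if s: "a < s" "s < t" "x j s \<noteq> 0" for s j
    proof (rule ccontr)
      assume "\<not> ?thesis"
      then have "?r l' < est i s" if "i \<in> pending t" for i
        using processed_least_est[of s j i] active[OF that s(1,2)] s a by auto
      then show False
        using at_most_one_falls_below[of l l' s t "?r l'"] l l' s a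
        by (force simp: pending_def)
    qed
    then show thesis
      using that[of l "?r l'"] l l' by auto
  qed
qed

lemma potential_bound:
  fixes K :: nat and T :: real
  assumes K: "1 / \<epsilon> \<le> real K" and M: "M \<subseteq> jobs I"
  defines "\<sigma> \<equiv> \<lambda>t. T - t - (\<Sum>j | j \<in> jobs I - M \<and> t \<le> release I j \<and> release I j < T. proc I j)"
  assumes slack: "\<And>t. 0 \<le> t \<Longrightarrow> t \<le> T \<Longrightarrow> 0 \<le> \<sigma> t"
    and t: "0 \<le> t" "t \<le> T" and \<theta>: "0 \<le> \<theta>" "\<And>j. j \<in> pending t \<Longrightarrow> \<theta> \<le> remaining I x j t"
  shows "(real (card (pending t)) - real K * real (card {j \<in> M. release I j < t})) * \<theta> \<le> \<sigma> t"
  using t \<theta>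
proof (induction "card {j \<in> jobs I. release I j < t}" arbitrary: t \<theta> rule: less_induct)
  case less
  let ?r = "\<lambda>j. remaining I x j t"
  let ?m = "\<lambda>t. card {j \<in> M. release I j < t}"
  \<comment> \<open>Kept as an integer: if it is positive it is at least 1, so \<open>X - 1\<close>
    is a nonnegative coefficient in the final estimate.\<close>
  define X where "X = int (card (pending t)) - int K * int (?m t)"
  have X: "real (card (pending t)) - real K * real (?m t) = of_int X" by (simp add: X_def)
  show ?case
  proof (cases "X \<le> 0")
    case True
    then have "of_int X * \<theta> \<le> 0" using less.prems by (intro mult_nonpos_nonneg) auto
    then show ?thesis unfolding X using slack[of t] less.prems by simp
  next
    case False
    then have ne: "pending t \<noteq> {}" by (auto simp: X_def)
    let ?R = "{j \<in> jobs I. release I j < t}"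
    have finR: "finite ?R" using finite_jobs by simp
    have R_ne: "?R \<noteq> {}" using ne by (auto simp: pending_def)
    define a where "a = Max (release I ` ?R)"
    have "a \<in> release I ` ?R" unfolding a_def using finR R_ne by (intro Max_in) auto
    then obtain i where i: "i \<in> ?R" "release I i = a" by auto
    have a: "0 \<le> a" "a < t" using i release_nonneg by auto
    have rel_le: "release I j \<le> a" if "j \<in> ?R" for j
      unfolding a_def using finR that by (intro Max_ge) auto
    have rel_pending: "release I j \<le> a" if "j \<in> pending t" for j
      using that rel_le by (simp add: pending_def)
    obtain l \<theta>' where l: "l \<in> pending t"
        "\<And>j. j \<in> pending t \<Longrightarrow> ?r l \<le> ?r j" "?r l \<le> \<theta>'"
        "\<And>j. j \<in> pending t \<Longrightarrow> j \<noteq> l \<Longrightarrow> \<theta>' \<le> ?r j"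
      and low: "\<And>s j. a < s \<Longrightarrow> s < t \<Longrightarrow> x j s \<noteq> 0 \<Longrightarrow> est j s \<le> \<theta>'"
      using rel_pending that by (rule second_smallest_threshold[OF less.prems(1) ne a(1)])
    have "l \<in> active I x s" if "a < s" "s < t" for s
      using that l(1) a rel_le[of l] remaining_antimono[of l s t]
      by (force simp: active_def pending_def)
    then have busy: "active I x s \<noteq> {}" if "a < s" "s < t" for s using that by blast
    have r_l: "0 < ?r l" "\<theta> \<le> ?r l" using l(1) less.prems by (auto simp: pending_def)
    have \<theta>': "0 \<le> \<theta>'" "\<theta> \<le> \<theta>'" using r_l l(3) by auto
    obtain t0 where t0: "0 \<le> t0" "t0 \<le> a"
      and busy': "\<And>s. t0 < s \<Longrightarrow> s < t \<Longrightarrow> active I x s \<noteq> {}"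
      and low': "\<And>s j. t0 < s \<Longrightarrow> s < t \<Longrightarrow> x j s \<noteq> 0 \<Longrightarrow> est j s \<le> \<theta>'"
      and old: "\<And>j. j \<in> pending t0 \<Longrightarrow> \<theta>' \<le> remaining I x j t0"
        "\<And>j. j \<in> pending t0 \<Longrightarrow> (1 - \<epsilon>) * \<theta>' \<le> \<epsilon> * elapsed x j t0"
      using busy low that by (rule last_high_time[OF a])
    have t0t: "t0 < t" using t0 a by simp
    \<comment> \<open>Job \<open>i\<close> is released at \<open>a\<close>, hence not before
      \<open>t0\<close>. This makes the number of released jobs drop strictly for the
      induction.\<close>
    have "i \<notin> {j \<in> jobs I. release I j < t0}" using i t0 by simp
    moreover have "{j \<in> jobs I. release I j < t0} \<subseteq> ?R" using t0t by auto
    ultimately have "{j \<in> jobs I. release I j < t0} \<subset> ?R" using i(1) by blast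
    then have "card {j \<in> jobs I. release I j < t0} < card ?R"
      using finR by (rule psubset_card_mono[rotated])
    then have IH: "(real (card (pending t0)) - real K * real (?m t0)) * \<theta>' \<le> \<sigma> t0"
      using less.hyps[of t0 \<theta>'] t0 t0t less.prems old(1) \<theta>' by simp
    let ?\<Phi> = "\<Sum>j | j \<in> jobs I \<and> release I j < t. min \<theta>' (?r j)"
    let ?M' = "{j \<in> M. t0 \<le> release I j \<and> release I j < t}"
    let ?W = "\<lambda>s u. \<Sum>j | j \<in> jobs I - M \<and> s \<le> release I j \<and> release I j < u. proc I j"
    have step: "?\<Phi> + (t - t0)
        \<le> real (card (pending t0)) * \<theta>' + real (card ?M') * (\<theta>' / \<epsilon>) + ?W t0 t"
      using potential_step[OF \<theta>'(1) t0(1) less_imp_le[OF t0t] M busy' low' old] by simp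
    have finM: "finite M" using M finite_jobs finite_subset by blast
    have "{j \<in> M. release I j < t} = {j \<in> M. release I j < t0} \<union> ?M'" using t0t by auto
    then have "?m t = card ({j \<in> M. release I j < t0} \<union> ?M')" by simp
    also have "\<dots> = ?m t0 + card ?M'" using finM by (intro card_Un_disjoint) auto
    finally have m: "?m t = ?m t0 + card ?M'" .
    have "{j. j \<in> jobs I - M \<and> t0 \<le> release I j \<and> release I j < T}
        = {j. j \<in> jobs I - M \<and> t0 \<le> release I j \<and> release I j < t}
          \<union> {j. j \<in> jobs I - M \<and> t \<le> release I j \<and> release I j < T}"
      using t0t less.prems by auto
    then have "?W t0 T = ?W t0 t + ?W t T"
      using finite_jobs by (simp add: sum.union_disjoint disjoint_iff)
    then have \<sigma>: "\<sigma> t0 = \<sigma> t + (t - t0) - ?W t0 t" by (simp add: \<sigma>_def)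
    \<comment> \<open>The allowance for each new job of \<open>M\<close> is absorbed by the growth
      of the term \<open>K * m\<close>.\<close>
    have "\<theta>' / \<epsilon> \<le> real K * \<theta>'" using mult_right_mono[OF K \<theta>'(1)] by simp
    then have "real (card ?M') * (\<theta>' / \<epsilon>) \<le> real (card ?M') * (real K * \<theta>')"
      by (intro mult_left_mono) auto
    with step IH have upper: "?\<Phi> \<le> real K * real (?m t) * \<theta>' + \<sigma> t"
      unfolding m \<sigma> by (simp add: algebra_simps)
    \<comment> \<open>In the potential every pending job counts fully as \<open>\<theta>'\<close>,
      except that \<open>l\<close> contributes only its own remaining time.\<close>
    have "(real (card (pending t)) - 1) * \<theta>' + ?r l = (\<Sum>j\<in>pending t. if j = l then ?r l else \<theta>')"
    proof -
      have "card (pending t - {l}) + 1 = card (pending t)"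
        using l(1) finite_pending card_Suc_Diff1[OF finite_pending l(1)] by simp
      then have "real (card (pending t)) - 1 = real (card (pending t - {l}))" by linarith
      moreover have "(\<Sum>j\<in>pending t - {l}. if j = l then ?r l else \<theta>') = (\<Sum>j\<in>pending t - {l}. \<theta>')"
        by (rule sum.cong) auto
      ultimately show ?thesis
        using sum.remove[OF finite_pending l(1), of "\<lambda>j. if j = l then ?r l else \<theta>'"] by simp
    qed
    also have "\<dots> \<le> (\<Sum>j\<in>pending t. min \<theta>' (?r j))"
      using l by (intro sum_mono) auto
    also have "\<dots> \<le> ?\<Phi>"
      using finR \<theta>' less.prems(1)
      by (intro sum_mono2) (auto simp: pending_def intro: remaining_nonneg)
    finally have "(of_int X - 1) * \<theta>' + ?r l \<le> \<sigma> t"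
      using upper unfolding X[symmetric] by (simp add: algebra_simps)
    \<comment> \<open>Lowering \<open>\<theta>'\<close> to \<theta> is allowed since
      \<open>X \<ge> 1\<close>; the one missing \<theta> is supplied by the remaining time of
      \<open>l\<close>.\<close>
    moreover have "(of_int X - 1) * \<theta> \<le> (of_int X - 1) * \<theta>'"
      using False \<theta>' by (intro mult_left_mono) auto
    ultimately have "of_int X * \<theta> \<le> \<sigma> t" using r_l by (simp add: algebra_simps)
    then show ?thesis unfolding X .
  qed
qed

section \<open>From pointwise job counts to flow times\<close>

text \<open>Take \<open>M\<close> to be the jobs that the competitor still has at \<open>T\<close>.
  Avoiding release times makes active and pending jobs coincide.\<close>

lemma card_active_le:
  fixes K :: nat
  assumes K: "1 / \<epsilon> \<le> real K" and y: "feasible I y"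
    and T: "0 \<le> T" "T \<notin> release I ` jobs I"
  shows "card (active I x T) \<le> K * card (active I y T)"
proof -
  interpret y: feasible_schedule I y by unfold_locales (fact valid, fact y)
  let ?M = "active I y T"
  have M: "?M \<subseteq> jobs I" by (auto simp: active_def)
  have active: "active I x T = pending T"
    using T(2) by (auto simp: active_def pending_def less_le)
  have M_rel: "{j \<in> ?M. release I j < T} = ?M"
    using T(2) by (auto simp: active_def less_le)
  \<comment> \<open>The competitor has done all the work of the jobs outside \<open>M\<close>
    released from \<open>t\<close> on, and it had only \<open>T - t\<close> time for it.\<close>
  have slack: "0 \<le> T - t - (\<Sum>j | j \<in> jobs I - ?M \<and> t \<le> release I j \<and> release I j < T. proc I j)"
    if t: "0 \<le> t" "t \<le> T" for t
  proof -
    let ?N = "{j. j \<in> jobs I - ?M \<and> t \<le> release I j \<and> release I j < T}"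
    have "(\<Sum>j\<in>?N. proc I j) \<le> (\<Sum>j\<in>?N. elapsed y j T - elapsed y j t)"
    proof (rule sum_mono)
      fix j assume j: "j \<in> ?N"
      then have "elapsed y j t = 0" using t by (intro y.elapsed_before_release) auto
      then show "proc I j \<le> elapsed y j T - elapsed y j t"
        using j by (auto simp: active_def remaining_def)
    qed
    also have "\<dots> \<le> T - t" using t by (intro y.work_le) auto
    finally show ?thesis by simp
  qed
  show ?thesis
  proof (cases "pending T = {}")
    case False
    define \<theta> where "\<theta> = Min ((\<lambda>j. remaining I x j T) ` pending T)"
    have "\<theta> \<in> (\<lambda>j. remaining I x j T) ` pending T"
      unfolding \<theta>_def using finite_pending False by (intro Min_in) auto
    then have "0 < \<theta>" by (auto simp: pending_def)
    have min: "\<theta> \<le> remaining I x j T" if "j \<in> pending T" for j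
      unfolding \<theta>_def using finite_pending that by (intro Min_le) auto
    \<comment> \<open>At \<open>t = T\<close> the slack is 0, since no job is released in an empty
      range. The positive factor \<theta> can then be cancelled.\<close>
    have "(real (card (pending T)) - real K * real (card {j \<in> ?M. release I j < T})) * \<theta>
        \<le> T - T - (\<Sum>j | j \<in> jobs I - ?M \<and> T \<le> release I j \<and> release I j < T. proc I j)"
      by (rule potential_bound[OF K M]) (use slack min \<open>0 < \<theta>\<close> T(1) in \<open>simp_all\<close>)
    then have "(real (card (pending T)) - real K * real (card ?M)) * \<theta> \<le> 0"
      unfolding M_rel by (simp add: not_less[symmetric])
    then have "real (card (pending T)) \<le> real (K * card ?M)"
      using \<open>0 < \<theta>\<close> by (simp add: mult_le_0_iff)
    then show ?thesis unfolding active by (simp only: of_nat_le_iff)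
  qed (simp add: active)
qed

end

text \<open>If the competitor never finishes some job, its flow time is infinite. Otherwise it is
  done by some horizon \<tau>; the count comparison shows that SLF is done then too, and both flow
  times are integrals over the same interval.\<close>

lemma (in SLF_run) flow_time_le:
  fixes K :: nat
  assumes K: "1 / \<epsilon> \<le> real K" and y: "feasible I y"
  shows "total_flow_time I x \<le> ereal (real K) * total_flow_time I y"
proof (cases "\<exists>j\<in>jobs I. \<forall>t\<ge>release I j. 0 < remaining I y j t")
  case True
  interpret y: feasible_schedule I y by unfold_locales (fact valid, fact y)
  from True obtain j where j: "j \<in> jobs I" "\<And>t. release I j \<le> t \<Longrightarrow> 0 < remaining I y j t" by blast
  have "completion_time I y j - ereal (release I j) = \<infinity>"
    using y.completion_time_infinite[of j] j(2) by simp
  with j(1) have "\<exists>j\<in>jobs I. completion_time I y j - ereal (release I j) = \<infinity>" by blast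
  then have "total_flow_time I y = \<infinity>"
    unfolding total_flow_time_def using finite_jobs by (simp only: sum_Pinfty simp_thms)
  moreover have "0 < real K" using K eps_pos by (meson less_le_trans zero_less_divide_1_iff)
  ultimately show ?thesis by simp
next
  case False
  interpret y: feasible_schedule I y by unfold_locales (fact valid, fact y)
  from False have "\<forall>j\<in>jobs I. \<exists>t. release I j \<le> t \<and> remaining I y j t \<le> 0"
    by (meson not_less)
  from bchoice[OF this] obtain d where "\<forall>j\<in>jobs I. release I j \<le> d j \<and> remaining I y j (d j) \<le> 0" ..
  then have d: "release I j \<le> d j" "remaining I y j (d j) \<le> 0" if "j \<in> jobs I" for j
    using that by auto
  have d_nonneg: "0 \<le> d j" if "j \<in> jobs I" for j
    using d(1)[OF that] release_nonneg[OF that] by simp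
  \<comment> \<open>Adding 1 puts \<tau> strictly after every release time, so the count comparison
    applies at \<tau>, and keeps it positive if there are no jobs.\<close>
  define \<tau> where "\<tau> = 1 + (\<Sum>j\<in>jobs I. d j)"
  have d_less: "d j < \<tau>" if "j \<in> jobs I" for j
  proof -
    have "d j \<le> (\<Sum>j\<in>jobs I. d j)"
      using that by (intro member_le_sum finite_jobs d_nonneg) auto
    then show ?thesis by (simp add: \<tau>_def)
  qed
  have "0 \<le> (\<Sum>j\<in>jobs I. d j)" by (intro sum_nonneg d_nonneg)
  then have \<tau>_pos: "0 < \<tau>" by (simp add: \<tau>_def)
  have \<tau>_rel: "release I j < \<tau>" if "j \<in> jobs I" for j
    using d(1)[OF that] d_less[OF that] by simp
  have y_done: "remaining I y j \<tau> \<le> 0" if j: "j \<in> jobs I" for j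
  proof -
    have "elapsed y j (d j) \<le> elapsed y j \<tau>"
      using j d(1)[OF j] d_less[OF j] release_nonneg[OF j] by (intro y.elapsed_mono) auto
    then show ?thesis using d(2)[OF j] by (simp add: remaining_def)
  qed
  then have y_empty: "active I y \<tau> = {}" by (simp add: active_def not_less)
  have "\<tau> \<notin> release I ` jobs I" 
  proof
    assume "\<tau> \<in> release I ` jobs I"
    then obtain j where "j \<in> jobs I" "\<tau> = release I j" ..
    with \<tau>_rel[of j] show False by simp
  qed
  then have "card (active I x \<tau>) = 0"
    using card_active_le[OF K y less_imp_le[OF \<tau>_pos]] by (simp add: y_empty)
  then have x_empty: "active I x \<tau> = {}" using finite_active by simp
  have x_done: "remaining I x j \<tau> \<le> 0" if j: "j \<in> jobs I" for j
  proof (rule ccontr)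
    assume "\<not> ?thesis"
    then have "j \<in> active I x \<tau>" using j \<tau>_rel[OF j] by (simp add: active_def)
    then show False by (simp add: x_empty)
  qed
  have ex: "\<exists>F. total_flow_time I z = ereal F \<and> ((\<lambda>s. real (card (active I z s))) has_integral F) {0..\<tau>}"
    if z: "feasible I z" "\<forall>j\<in>jobs I. remaining I z j \<tau> \<le> 0" for z
  proof -
    interpret z: feasible_schedule I z by unfold_locales (fact valid, fact z(1))
    let ?C = "\<lambda>j c. completion_time I z j = ereal c \<and> release I j \<le> c \<and> c \<le> \<tau> \<and>
        (\<forall>s. s \<noteq> c \<longrightarrow> (j \<in> active I z s \<longleftrightarrow> release I j \<le> s \<and> s < c))"
    have "\<forall>j\<in>jobs I. \<exists>c. ?C j c"
    proof
      fix j assume j: "j \<in> jobs I"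
      obtain c where "completion_time I z j = ereal c" "release I j \<le> c" "c \<le> \<tau>"
          "\<And>s. s \<noteq> c \<Longrightarrow> j \<in> active I z s \<longleftrightarrow> release I j \<le> s \<and> s < c"
        using that by (rule z.completion_time_finite[OF j less_imp_le[OF \<tau>_rel[OF j]] bspec[OF z(2) j]])
      then have "?C j c" by simp
      then show "\<exists>c. ?C j c" by (rule exI)
    qed
    from bchoice[OF this] obtain c where c: "\<forall>j\<in>jobs I. ?C j (c j)" ..
    obtain F where "total_flow_time I z = ereal F"
        "((\<lambda>s. real (card (active I z s))) has_integral F) {0..\<tau>}"
      by (rule z.flow_time_eq_integral_active[of c \<tau>]) (use c in simp_all)
    then show ?thesis by (intro exI conjI)
  qed
  obtain F where F: "total_flow_time I x = ereal F"
      "((\<lambda>s. real (card (active I x s))) has_integral F) {0..\<tau>}"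
    using ex[OF feas] x_done by blast
  obtain G where G: "total_flow_time I y = ereal G"
      "((\<lambda>s. real (card (active I y s))) has_integral G) {0..\<tau>}"
    using ex[OF y] y_done by blast
  let ?R = "release I ` jobs I"
  \<comment> \<open>The count comparison says nothing at release times; there are finitely many, so
    the integrand is set to 0 there.\<close>
  have "((\<lambda>s. if s \<in> ?R then 0 else real (card (active I x s))) has_integral F) {0..\<tau>}"
    by (rule has_integral_spike_finite[OF _ _ F(2), of ?R]) (use finite_jobs in auto)
  moreover have "((\<lambda>s. real K * real (card (active I y s))) has_integral real K * G) {0..\<tau>}"
    using has_integral_mult_right[OF G(2)] by simp
  moreover have "(if s \<in> ?R then 0 else real (card (active I x s))) \<le> real K * real (card (active I y s))"
    if "s \<in> {0..\<tau>}" for s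
    using card_active_le[OF K y, of s] that by (auto simp flip: of_nat_mult)
  ultimately have "F \<le> real K * G" by (rule has_integral_le)
  then show ?thesis by (simp add: F(1) G(1))
qed

theorem theorem1p1:
  fixes \<epsilon> :: real
  assumes "0 < \<epsilon>" and "\<epsilon> \<le> 1"
  shows "competitive \<epsilon> (SLF \<epsilon> :: 'j policy) (real_of_int \<lceil>1 / \<epsilon>\<rceil>)"
  unfolding competitive_def
proof (intro allI impI)
  fix I :: "'j job_instance" and x
  assume I: "valid_instance I" and x: "policy_run \<epsilon> (SLF \<epsilon>) I x"
  interpret SLF_run I x \<epsilon>
    by unfold_locales (use I x assms in \<open>auto simp: policy_run_def\<close>)
  define K where "K = nat \<lceil>1 / \<epsilon>\<rceil>"
  have ceil: "0 < \<lceil>1 / \<epsilon>\<rceil>" using assms by simp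
  then have K_eq: "real K = real_of_int \<lceil>1 / \<epsilon>\<rceil>" by (simp add: K_def)
  then have K: "1 / \<epsilon> \<le> real K" and K_pos: "0 < ereal (real K)" using ceil by simp_all
  \<comment> \<open>Dividing by the positive \<open>K\<close> turns the claim into a lower bound on
    the infimum, which can be checked for each competing schedule.\<close>
  have "total_flow_time I x / ereal (real K) \<le> opt_flow_time I"
    unfolding opt_flow_time_def
  proof (rule INF_greatest)
    fix y assume "y \<in> {x. feasible I x}"
    then show "total_flow_time I x / ereal (real K) \<le> total_flow_time I y"
      using flow_time_le[OF K, of y] K_pos by (simp add: ereal_divide_le_pos)
  qed
  then show "total_flow_time I x \<le> ereal (real_of_int \<lceil>1 / \<epsilon>\<rceil>) * opt_flow_time I"
    using K_pos by (simp add: ereal_divide_le_pos K_eq)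
qed

end
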